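(* Let $\mathcal{X}\subseteq\mathbb{R}^n$ be a compact set, and let $f,h_1,\dots,h_m:\mathcal{X}\to\mathbb{R}$ be continuous functions such that $h_j(x)\ge 0$ for all $x\in\mathcal{X}$, $j=1,\dots,m$. Suppose there is $x\in\mathcal{X}$ with $h_j(x)=0$ for all $j=1,\dots,m$. Let $(y_\ell)_{\ell\in\mathbb{N}}\subset\mathbb{R}$ be an increasing sequence of positive numbers diverging to infinity, and for each $\ell\in\mathbb{N}$ let $$\hat x_\ell\in\operatorname{argmin}\Big\{f(x)+y_\ell\sum_{j=1}^m h_j(x): x\in\mathcal{X}\Big\}.$$ Then every accumulation point of $(\hat x_\ell)_{\ell\in\mathbb{N}}$ is an optimal solution of the problem $$\min\{f(x): h_j(x)=0,\ j=1,\dots,m,\ x\in\mathcal{X}\}.$$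
   Context: An accumulation point of a sequence is the limit of some convergent subsequence. *)

theory Defs
  imports "HOL-Analysis.Analysis"
begin

definition accumulation_point :: "(nat \<Rightarrow> 'a::topological_space) \<Rightarrow> 'a \<Rightarrow> bool" where
  "accumulation_point x p \<longleftrightarrow> (\<exists>r::nat \<Rightarrow> nat. strict_mono r \<and> (x \<circ> r) \<longlonglongrightarrow> p)"

end

theory Submission
  imports Defs
begin

text \<open>
  Comparing the minimiser at stage l with a feasible point z gives
  f (xhat l) + y l * H (xhat l) \<le> f z, where H is the sum of the h j. Hence f (xhat l) \<le> f z and
  H (xhat l) \<le> (f z - f (xhat l)) / y l; along the convergent subsequence the last bound tends to 0,
  so the limit is feasible and no worse than z.
\<close>

theorem theorem2:
  fixes X :: "(real ^ 'n) set"
    and f :: "real ^ 'n \<Rightarrow> real"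
    and m :: nat
    and h :: "nat \<Rightarrow> real ^ 'n \<Rightarrow> real"
    and y :: "nat \<Rightarrow> real"
    and xhat :: "nat \<Rightarrow> real ^ 'n"
    and p :: "real ^ 'n"
  assumes "compact X"
    and "continuous_on X f"
    and "\<And>j. j \<in> {1..m} \<Longrightarrow> continuous_on X (h j)"
    and "\<And>j x. j \<in> {1..m} \<Longrightarrow> x \<in> X \<Longrightarrow> 0 \<le> h j x"
    and "\<exists>x\<in>X. \<forall>j\<in>{1..m}. h j x = 0"
    and "incseq y"
    and "\<And>l. 0 < y l"
    and "filterlim y at_top sequentially"
    and "\<And>l. is_arg_min (\<lambda>x. f x + y l * (\<Sum>j=1..m. h j x)) (\<lambda>x. x \<in> X) (xhat l)"
    and "accumulation_point xhat p"
  shows "is_arg_min f (\<lambda>x. x \<in> X \<and> (\<forall>j\<in>{1..m}. h j x = 0)) p"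
proof -
  define H where "H x = (\<Sum>j=1..m. h j x)" for x
  obtain r where r: "strict_mono r" and lim: "(\<lambda>l. xhat (r l)) \<longlonglongrightarrow> p"
    using assms(10) by (auto simp: accumulation_point_def o_def)
  have xX: "xhat l \<in> X" for l
    using assms(9) by (simp add: is_arg_min_def)
  \<comment> \<open>Compactness enters through closedness: \<open>X\<close> contains the limit, so
    continuity of \<open>f\<close> and \<open>H\<close> on \<open>X\<close> can be used at
    \<open>p\<close>.\<close>
  have pX: "p \<in> X"
    using compact_imp_closed[OF assms(1)] xX lim by (rule closed_sequentially)
  have flim: "(\<lambda>l. f (xhat (r l))) \<longlonglongrightarrow> f p"
    using assms(2) lim pX xX by (intro continuous_on_tendsto_compose[of X f]) auto
  have "continuous_on X H"
    unfolding H_def using assms(3) by (intro continuous_on_sum)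
  then have Hlim: "(\<lambda>l. H (xhat (r l))) \<longlonglongrightarrow> H p"
    using lim pX xX by (intro continuous_on_tendsto_compose[of X H]) auto
  have Hnn: "0 \<le> H x" if "x \<in> X" for x
    unfolding H_def using assms(4) that by (intro sum_nonneg)
  \<comment> \<open>The penalty vanishes at a feasible \<open>z\<close>, so the bound is the same
    for every \<open>l\<close>.\<close>
  have min: "f (xhat l) + y l * H (xhat l) \<le> f z"
    if z: "z \<in> X" "\<forall>j\<in>{1..m}. h j z = 0" for z l
  proof -
    have "H z = 0" using z unfolding H_def by simp
    then show ?thesis
      using assms(9)[of l] z(1) by (fastforce simp: is_arg_min_linorder H_def)
  qed
  have fle: "f p \<le> f z" if z: "z \<in> X" "\<forall>j\<in>{1..m}. h j z = 0" for z
  proof (rule LIMSEQ_le_const2[OF flim], intro exI allI impI)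
    fix l
    have "0 \<le> y (r l) * H (xhat (r l))"
      using assms(7) Hnn xX by (simp add: less_imp_le)
    then show "f (xhat (r l)) \<le> f z" using min[OF z, of "r l"] by linarith
  qed
  \<comment> \<open>Feasibility of \<open>p\<close> needs only one fixed feasible point for
    comparison.\<close>
  obtain z where z: "z \<in> X" "\<forall>j\<in>{1..m}. h j z = 0" using assms(5) by blast
  have "filterlim (\<lambda>l. y (r l)) at_top sequentially"
    using assms(8) filterlim_subseq[OF r] by (rule filterlim_compose)
  \<comment> \<open>The numerator has the finite limit \<open>f z - f p\<close>, while the
    denominator diverges along the subsequence.\<close>
  then have "(\<lambda>l. (f z - f (xhat (r l))) / y (r l)) \<longlonglongrightarrow> 0"
    using flim by (intro real_tendsto_divide_at_top[of _ "f z - f p"] tendsto_intros)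
  moreover have "H (xhat (r l)) \<le> (f z - f (xhat (r l))) / y (r l)" for l
    using min[OF z, of "r l"] assms(7)[of "r l"] by (simp add: pos_le_divide_eq algebra_simps)
  ultimately have "H p \<le> 0"
    using Hlim by (intro LIMSEQ_le) auto
  then have "H p = 0" using Hnn[OF pX] by simp
  \<comment> \<open>A sum of nonnegative terms is zero only if each term is, so
    \<open>H p = 0\<close> gives every constraint separately.\<close>
  then have "\<forall>j\<in>{1..m}. h j p = 0"
    unfolding H_def using assms(4) pX by (subst (asm) sum_nonneg_eq_0_iff) auto
  then show ?thesis
    using pX fle by (simp add: is_arg_min_linorder)
qed

end
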